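(* For every Boolean function $f:\{0,1\}^n\times\{0,1\}^n\to\{0,1\}$ and every $k\ge1$, $GH_k(f)=\Omega(2^{D_k(f)/k})$.
   Context: Garden-hose model: Alice holds $x$, Bob holds $y$. A garden-hose protocol of size $s$ consists of a set $V$ of $s$ vertices (pipes) and an extra vertex $t$ (the tap), together with an assignment of a matching $E_A(x)$ on $V\cup\{t\}$ to every input $x$ of Alice and a matching $E_B(y)$ on $V$ to every input $y$ of Bob. In the graph $(V\cup\{t\},E_A(x)\cup E_B(y))$ every vertex has degree at most 2, so there is a unique maximal path starting at $t$ (the path of the water); the output on $(x,y)$ is the parity of the number of edges of this path. The protocol computes $f$ if the output equals $f(x,y)$ for all $(x,y)$. The wet pipes on input $(x,y)$ are the pipes on this path; $T_P$ is the maximum number of wet pipes over all inputs. $GH_k(f)$ is the minimum size of a garden-hose protocol $P$ computing $f$ with $T_P\le k$. $D_k(f)$ is the deterministic communication complexity of $f$ with protocols exchanging at most $k$ messages, Alice sending first.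
   Formalization: Protocols must have at least one pipe: otherwise the constant-0 function has a protocol of size 0 and D_k = 0, so the bound 0 ≥ c·2^0 fails; no other function is affected. *)

theory Defs
  imports Complex_Main "HOL-Library.Extended_Real"
begin

type_synonym bits = "bool list"

definition cube :: "nat \<Rightarrow> bits set" where
  "cube n = {x. length x = n}"

definition matching_on :: "'v set \<Rightarrow> 'v set set \<Rightarrow> bool" where
  "matching_on W M \<longleftrightarrow> (\<forall>e\<in>M. e \<subseteq> W \<and> card e = 2) \<and> pairwise disjnt M"

text \<open>A path is a nonempty list of distinct vertices, so it has one edge less than its length.\<close>

definition path_from :: "'v set set \<Rightarrow> 'v \<Rightarrow> 'v list \<Rightarrow> bool" where
  "path_from E t p \<longleftrightarrow> p \<noteq> [] \<and> hd p = t \<and> distinct p \<and>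
     (\<forall>i. Suc i < length p \<longrightarrow> {p ! i, p ! Suc i} \<in> E)"

definition maximal_path_from :: "'v set set \<Rightarrow> 'v \<Rightarrow> 'v list \<Rightarrow> bool" where
  "maximal_path_from E t p \<longleftrightarrow> path_from E t p \<and> (\<forall>v. \<not> path_from E t (p @ [v]))"

lemma matching_unique:
  assumes "matching_on W M" "{w, a} \<in> M" "{w, b} \<in> M"
  shows "a = b"
proof -
  have "\<not> disjnt {w, a} {w, b}"
    by (auto simp: disjnt_def)
  then have "{w, a} = {w, b}"
    using assms pairwiseD[of disjnt M "{w, a}" "{w, b}"] by (auto simp: matching_on_def)
  then show ?thesis
    by (metis doubleton_eq_iff)
qed

lemma path_from_agree:
  assumes A: "matching_on (insert t V) A" and B: "matching_on V B" and t: "t \<notin> V"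
    and p: "path_from (A \<union> B) t p" and q: "path_from (A \<union> B) t q"
    and "i < length p" "i < length q"
  shows "p ! i = q ! i"
  using assms(6,7)
proof (induction i rule: less_induct)
  case (less i)
  show ?case
  proof (cases i)
    case 0
    then show ?thesis
      using p q by (simp add: path_from_def flip: hd_conv_nth)
  next
    case (Suc j)
    have w: "p ! j = q ! j"
      using less Suc by simp
    have ep: "{p ! j, p ! i} \<in> A \<union> B"
      using p less.prems Suc by (auto simp: path_from_def)
    have eq: "{p ! j, q ! i} \<in> A \<union> B"
      using q less.prems Suc w by (auto simp: path_from_def)
    show ?thesis
    proof (cases j)
      case 0
      have "p ! j = t"
        using p 0 by (simp add: path_from_def flip: hd_conv_nth)
      then have "{p ! j, p ! i} \<in> A" "{p ! j, q ! i} \<in> A"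
        using ep eq B t unfolding matching_on_def by auto
      then show ?thesis
        by (rule matching_unique[OF A])
    next
      case (Suc l)
      have u: "p ! l = q ! l"
        using less \<open>i = Suc j\<close> Suc by simp
      have "{p ! l, p ! j} \<in> A \<union> B"
        using p less.prems \<open>i = Suc j\<close> Suc by (simp add: path_from_def)
      then have el: "{p ! j, p ! l} \<in> A \<union> B"
        by (subst insert_commute)
      have "p ! i \<noteq> p ! l"
        using p less.prems \<open>i = Suc j\<close> Suc by (simp add: path_from_def nth_eq_iff_index_eq)
      moreover have "q ! i \<noteq> p ! l"
        using q less.prems \<open>i = Suc j\<close> Suc u by (simp add: path_from_def nth_eq_iff_index_eq)
      ultimately show ?thesis
        using ep eq el matching_unique[OF A, of "p ! j"] matching_unique[OF B, of "p ! j"]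
        by (metis Un_iff)
    qed
  qed
qed

lemma ex1_maximal_path_from:
  assumes A: "matching_on (insert t V) A" and B: "matching_on V B"
    and t: "t \<notin> V" and V: "finite V"
  shows "\<exists>!p. maximal_path_from (A \<union> B) t p"
proof -
  have sub: "set p \<subseteq> insert t V" if p: "path_from (A \<union> B) t p" for p
  proof
    fix v assume "v \<in> set p"
    then obtain i where i: "i < length p" "v = p ! i"
      by (metis in_set_conv_nth)
    show "v \<in> insert t V"
    proof (cases i)
      case 0
      then show ?thesis
        using p i by (simp add: path_from_def flip: hd_conv_nth)
    next
      case (Suc j)
      then have "{p ! j, v} \<in> A \<union> B"
        using p i by (auto simp: path_from_def)
      then show ?thesis
        using A B by (auto simp: matching_on_def)
    qed
  qed
  have len: "length p \<le> Suc (card V)" if p: "path_from (A \<union> B) t p" for p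
    using card_mono[OF _ sub[OF p]] p V t by (simp add: path_from_def distinct_card)
  have "path_from (A \<union> B) t [t]"
    by (simp add: path_from_def)
  then have "\<exists>p. path_from (A \<union> B) t p \<and>
      (\<forall>q. path_from (A \<union> B) t q \<longrightarrow> length q \<le> length p)"
    by (rule ex_has_greatest_nat[where b = "Suc (Suc (card V))"])
      (intro allI impI le_imp_less_Suc len)
  then obtain p where p: "path_from (A \<union> B) t p"
    "\<forall>q. path_from (A \<union> B) t q \<longrightarrow> length q \<le> length p"
    by (elim exE conjE)
  have "\<not> path_from (A \<union> B) t (p @ [v])" for v
    using p(2)[rule_format, of "p @ [v]"] by auto
  then have ex: "maximal_path_from (A \<union> B) t p"
    using p(1) by (simp add: maximal_path_from_def)
  have le: "length q \<le> length p"
    if "maximal_path_from (A \<union> B) t p" "path_from (A \<union> B) t q" for p q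
  proof (rule ccontr)
    assume *: "\<not> length q \<le> length p"
    have p: "path_from (A \<union> B) t p"
      using that by (simp add: maximal_path_from_def)
    have "take (length p) q = p"
      using * path_from_agree[OF A B t p that(2)] by (intro nth_equalityI) auto
    then have eq: "p @ [q ! length p] = take (Suc (length p)) q"
      using * take_Suc_conv_app_nth[of "length p" q] by simp
    have "path_from (A \<union> B) t (take (Suc (length p)) q)"
      using that(2) by (auto simp: path_from_def hd_take)
    then show False
      using that(1) unfolding maximal_path_from_def eq[symmetric] by blast
  qed
  show ?thesis
  proof (rule ex1I)
    show "maximal_path_from (A \<union> B) t p"
      by (rule ex)
  next
    fix q assume q: "maximal_path_from (A \<union> B) t q"
    have pq: "path_from (A \<union> B) t p" "path_from (A \<union> B) t q"
      using ex q by (simp_all add: maximal_path_from_def)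
    then have "length q = length p"
      using le[OF ex pq(2)] le[OF q pq(1)] by simp
    then show "q = p"
      using path_from_agree[OF A B t pq] by (intro nth_equalityI) auto
  qed
qed

text \<open>Since only the number of vertices matters, vertices are natural numbers. The two matchings
  are relevant only on inputs from the cube.\<close>

record garden_hose =
  pipes :: "nat set"
  tap :: nat
  alice :: "bits \<Rightarrow> nat set set"
  bob :: "bits \<Rightarrow> nat set set"

text \<open>The pipe set is required to be nonempty. Otherwise the function that is constantly 0 would
  have a protocol of size 0, which no lower bound of the form \<open>c * 2 powr (d / k)\<close> with
  \<open>c > 0\<close> can match.  All other functions need at least one pipe anyway.\<close>

definition gh_protocol :: "nat \<Rightarrow> garden_hose \<Rightarrow> bool" where
  "gh_protocol n P \<longleftrightarrow> finite (pipes P) \<and> pipes P \<noteq> {} \<and> tap P \<notin> pipes P \<and>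
     (\<forall>x\<in>cube n. matching_on (insert (tap P) (pipes P)) (alice P x)) \<and>
     (\<forall>y\<in>cube n. matching_on (pipes P) (bob P y))"

definition gh_size :: "garden_hose \<Rightarrow> nat" where
  "gh_size P = card (pipes P)"

definition water_path :: "garden_hose \<Rightarrow> bits \<Rightarrow> bits \<Rightarrow> nat list" where
  "water_path P x y = (THE p. maximal_path_from (alice P x \<union> bob P y) (tap P) p)"

definition gh_output :: "garden_hose \<Rightarrow> bits \<Rightarrow> bits \<Rightarrow> bool" where
  "gh_output P x y \<longleftrightarrow> odd (length (water_path P x y) - 1)"

definition gh_computes :: "nat \<Rightarrow> garden_hose \<Rightarrow> (bits \<Rightarrow> bits \<Rightarrow> bool) \<Rightarrow> bool" where
  "gh_computes n P f \<longleftrightarrow> (\<forall>x\<in>cube n. \<forall>y\<in>cube n. gh_output P x y = f x y)"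

definition wet_pipes :: "garden_hose \<Rightarrow> bits \<Rightarrow> bits \<Rightarrow> nat set" where
  "wet_pipes P x y = set (water_path P x y) \<inter> pipes P"

definition gh_time :: "nat \<Rightarrow> garden_hose \<Rightarrow> nat" where
  "gh_time n P = Max ((\<lambda>(x, y). card (wet_pipes P x y)) ` (cube n \<times> cube n))"

text \<open>The value is \<open>\<infinity>\<close> if there is no protocol with at most \<open>k\<close> wet pipes.\<close>

definition GH :: "nat \<Rightarrow> nat \<Rightarrow> (bits \<Rightarrow> bits \<Rightarrow> bool) \<Rightarrow> enat" where
  "GH n k f = (INF P \<in> {P. gh_protocol n P \<and> gh_computes n P f \<and> gh_time n P \<le> k}.
     enat (gh_size P))"

text \<open>Two-party protocols are binary trees in which one party sends one bit at each inner node and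
  the leaves carry the output, i.e. the transcript determines the output. A message is a maximal
  block of consecutive bits sent by the same party. (If only the receiver of the last message had
  to know the output, the complexity could only decrease.)\<close>

datatype party = Alice | Bob

datatype comm =
    is_Leaf: Leaf bool
  | is_Send_Alice: Send_Alice "bits \<Rightarrow> bool" comm comm
  | is_Send_Bob: Send_Bob "bits \<Rightarrow> bool" comm comm

primrec comm_output :: "comm \<Rightarrow> bits \<Rightarrow> bits \<Rightarrow> bool" where
  "comm_output (Leaf b) x y = b"
| "comm_output (Send_Alice g T U) x y = (if g x then comm_output T x y else comm_output U x y)"
| "comm_output (Send_Bob g T U) x y = (if g y then comm_output T x y else comm_output U x y)"

primrec comm_cost :: "comm \<Rightarrow> nat" where
  "comm_cost (Leaf b) = 0"
| "comm_cost (Send_Alice g T U) = Suc (max (comm_cost T) (comm_cost U))"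
| "comm_cost (Send_Bob g T U) = Suc (max (comm_cost T) (comm_cost U))"

text \<open>The first argument of \<open>messages\<close> is the sender of the previous bit, if any; only a change of
  sender starts a new message.\<close>

primrec messages :: "party option \<Rightarrow> comm \<Rightarrow> nat" where
  "messages s (Leaf b) = 0"
| "messages s (Send_Alice g T U) = (if s = Some Alice then 0 else 1) +
     max (messages (Some Alice) T) (messages (Some Alice) U)"
| "messages s (Send_Bob g T U) = (if s = Some Bob then 0 else 1) +
     max (messages (Some Bob) T) (messages (Some Bob) U)"

definition alice_first :: "comm \<Rightarrow> bool" where
  "alice_first T \<longleftrightarrow> \<not> is_Send_Bob T"

definition comm_computes :: "nat \<Rightarrow> comm \<Rightarrow> (bits \<Rightarrow> bits \<Rightarrow> bool) \<Rightarrow> bool" where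
  "comm_computes n T f \<longleftrightarrow> (\<forall>x\<in>cube n. \<forall>y\<in>cube n. comm_output T x y = f x y)"

text \<open>The value can be \<open>\<infinity>\<close> only for \<open>k \<le> 1\<close>, namely if the output depends on
  the input of Bob, who does not send anything.\<close>

definition DCC :: "nat \<Rightarrow> nat \<Rightarrow> (bits \<Rightarrow> bits \<Rightarrow> bool) \<Rightarrow> enat" where
  "DCC n k f = (INF T \<in> {T. alice_first T \<and> comm_computes n T f \<and> messages None T \<le> k}.
     enat (comm_cost T))"

definition two_powr_div :: "enat \<Rightarrow> nat \<Rightarrow> ereal" where
  "two_powr_div d k = (case d of enat m \<Rightarrow> ereal (2 powr (real m / real k)) | \<infinity> \<Rightarrow> \<infinity>)"

end

theory Submission
  imports Defs
begin

text \<open>Alice and Bob follow the water. As long as the path continues, the owner of the next edge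
  announces the pipe at its other end, or that there is none; at most \<open>k\<close> announcements are needed
  because at most \<open>k\<close> pipes get wet. With \<open>s\<close> pipes an announcement is one of \<open>s + 1\<close> symbols and
  takes \<open>b\<close> bits for some \<open>b\<close> with \<open>s < 2 ^ b \<le> 2 * s\<close>. Hence \<open>D\<^sub>k(f) \<le> k * b\<close> and
  \<open>2 powr (D\<^sub>k(f) / k) \<le> 2 * s\<close>.\<close>

section \<open>Sending numbers bit by bit\<close>

fun other :: "party \<Rightarrow> party" where
  "other Alice = Bob"
| "other Bob = Alice"

fun input_of :: "party \<Rightarrow> bits \<Rightarrow> bits \<Rightarrow> bits" where
  "input_of Alice x y = x"
| "input_of Bob x y = y"

fun send_bit :: "party \<Rightarrow> (bits \<Rightarrow> bool) \<Rightarrow> comm \<Rightarrow> comm \<Rightarrow> comm" where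
  "send_bit Alice = Send_Alice"
| "send_bit Bob = Send_Bob"

lemma comm_output_send_bit [simp]:
  "comm_output (send_bit a g T U) x y =
     (if g (input_of a x y) then comm_output T x y else comm_output U x y)"
  by (cases a) auto

lemma comm_cost_send_bit [simp]:
  "comm_cost (send_bit a g T U) = Suc (max (comm_cost T) (comm_cost U))"
  by (cases a) auto

lemma messages_send_bit [simp]:
  "messages s (send_bit a g T U) = (if s = Some a then 0 else 1) +
     max (messages (Some a) T) (messages (Some a) U)"
  by (cases a) auto

text \<open>The tree that continues the conversation is indexed by the number received. The least
  significant bit goes first, so the quotient \<open>c\<close> still to be sent stands for
  \<open>2 * c + 1\<close> or \<open>2 * c\<close>.\<close>

primrec send_number :: "party \<Rightarrow> nat \<Rightarrow> (bits \<Rightarrow> nat) \<Rightarrow> (nat \<Rightarrow> comm) \<Rightarrow> comm" where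
  "send_number a 0 g K = K 0"
| "send_number a (Suc b) g K = send_bit a (\<lambda>z. odd (g z))
     (send_number a b (\<lambda>z. g z div 2) (\<lambda>c. K (2 * c + 1)))
     (send_number a b (\<lambda>z. g z div 2) (\<lambda>c. K (2 * c)))"

lemma comm_output_send_number:
  assumes "g (input_of a x y) < 2 ^ b"
  shows "comm_output (send_number a b g K) x y = comm_output (K (g (input_of a x y))) x y"
  using assms
proof (induction b arbitrary: g K)
  case (Suc b)
  then have "g (input_of a x y) div 2 < 2 ^ b"
    by (simp add: div_less_iff_less_mult mult.commute)
  then show ?case
    using Suc.IH[of "\<lambda>z. g z div 2"] by (simp flip: mult_2)
qed simp

lemma comm_cost_send_number:
  assumes "\<And>c. comm_cost (K c) \<le> d"
  shows "comm_cost (send_number a b g K) \<le> b + d"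
  using assms by (induction b arbitrary: g K) auto

text \<open>When \<open>a\<close> spoke last, all these bits prolong the current message and cost
  nothing.\<close>

lemma messages_send_number:
  assumes "\<And>c. messages (Some a) (K c) \<le> m"
  shows "messages (Some a) (send_number a b g K) \<le> m"
  using assms by (induction b arbitrary: g K) auto

text \<open>Only the first bit can open a message; after it \<open>a\<close> is the previous sender,
  whatever \<open>s\<close> was. This makes each announcement at most one message.\<close>

lemma messages_send_number_Suc:
  assumes "\<And>c. messages (Some a) (K c) \<le> m"
  shows "messages s (send_number a (Suc b) g K) \<le> Suc m"
  using messages_send_number[OF assms] by (auto intro: le_SucI)

section \<open>The protocol that follows the water\<close>

fun edges :: "garden_hose \<Rightarrow> party \<Rightarrow> bits \<Rightarrow> nat set set" where
  "edges P Alice = alice P"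
| "edges P Bob = bob P"

text \<open>The announcer has only its own input \<open>z\<close> and the public path
  \<open>q\<close> to go by. In a matching at most one vertex qualifies, so \<open>SOME\<close>
  makes no real choice there.\<close>

definition next_pipe :: "garden_hose \<Rightarrow> party \<Rightarrow> nat list \<Rightarrow> bits \<Rightarrow> nat option" where
  "next_pipe P a q z =
     (if \<exists>v. v \<notin> set q \<and> {last q, v} \<in> edges P a z
      then Some (SOME v. v \<notin> set q \<and> {last q, v} \<in> edges P a z) else None)"

text \<open>Here \<open>r\<close> is the number of announcements left and \<open>q\<close> is the path announced so far.\<close>

primrec follow_water :: "garden_hose \<Rightarrow> nat \<Rightarrow> (nat option \<Rightarrow> nat) \<Rightarrow> (nat \<Rightarrow> nat option) \<Rightarrow>
    nat \<Rightarrow> party \<Rightarrow> nat list \<Rightarrow> comm" where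
  "follow_water P b enc dec 0 a q = Leaf (odd (length q - 1))"
| "follow_water P b enc dec (Suc r) a q =
     send_number a b (\<lambda>z. enc (next_pipe P a q z))
       (\<lambda>c. case dec c of None \<Rightarrow> Leaf (odd (length q - 1))
          | Some v \<Rightarrow> follow_water P b enc dec r (other a) (q @ [v]))"

lemma comm_cost_follow_water: "comm_cost (follow_water P b enc dec r a q) \<le> r * b"
  by (induction r arbitrary: a q) (auto intro!: comm_cost_send_number split: option.split)

lemma messages_follow_water: "messages s (follow_water P (Suc b) enc dec r a q) \<le> r"
proof (induction r arbitrary: s a q)
  case (Suc r)
  then show ?case
    unfolding follow_water.simps
    by (intro messages_send_number_Suc) (auto split: option.split)
qed simp

lemma alice_first_follow_water: "alice_first (follow_water P (Suc b) enc dec r Alice q)"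
  by (cases r) (simp_all add: alice_first_def)

section \<open>Paths and correctness of the protocol\<close>

lemma matching_on_mono: "matching_on W M \<Longrightarrow> W \<subseteq> W' \<Longrightarrow> matching_on W' M"
  unfolding matching_on_def by blast

lemma path_from_subset:
  assumes "path_from E t p" "\<And>e. e \<in> E \<Longrightarrow> e \<subseteq> W" "t \<in> W"
  shows "set p \<subseteq> W"
proof
  fix v assume "v \<in> set p"
  then obtain i where i: "i < length p" "v = p ! i"
    by (metis in_set_conv_nth)
  show "v \<in> W"
  proof (cases i)
    case 0
    then show ?thesis
      using assms i by (simp add: path_from_def flip: hd_conv_nth)
  next
    case (Suc j)
    then have "{p ! j, v} \<in> E"
      using assms i by (auto simp: path_from_def)
    then show ?thesis
      using assms(2) by blast
  qed
qed

lemma path_from_append_Cons: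
  assumes "path_from E t (q @ v # r)" "q \<noteq> []"
  shows "{last q, v} \<in> E" "v \<notin> set q"
proof -
  have len: "length q - 1 < length q" "Suc (length q - 1) = length q"
    using assms(2) by simp_all
  have "{(q @ v # r) ! (length q - 1), (q @ v # r) ! Suc (length q - 1)} \<in> E"
    using assms(1) len(1) unfolding path_from_def by simp
  then show "{last q, v} \<in> E"
    unfolding len(2) last_conv_nth[OF assms(2)] nth_append_length using len(1)
    by (simp only: nth_append if_True)
  show "v \<notin> set q"
    using assms(1) by (simp add: path_from_def)
qed

lemma path_from_snoc:
  assumes "path_from E t q" "{last q, v} \<in> E" "v \<notin> set q"
  shows "path_from E t (q @ [v])"
  unfolding path_from_def
proof (intro conjI allI impI)
  fix i assume i: "Suc i < length (q @ [v])"
  show "{(q @ [v]) ! i, (q @ [v]) ! Suc i} \<in> E"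
  proof (cases "Suc i < length q")
    case True
    then show ?thesis
      using assms(1) by (simp add: path_from_def nth_append)
  next
    case False
    then have "i = length q - 1" "q \<noteq> []"
      using i assms(1) by (auto simp: path_from_def)
    then show ?thesis
      using assms(2) by (simp add: nth_append last_conv_nth)
  qed
qed (use assms in \<open>auto simp: path_from_def\<close>)

text \<open>The last assumption says that the water arrived at \<open>last q\<close> through an edge of the other
  party, so that only \<open>a\<close> can continue the path.\<close>

lemma comm_output_follow_water:
  assumes max: "maximal_path_from (alice P x \<union> bob P y) t (q @ p)"
    and A: "matching_on W (alice P x)" and B: "matching_on W (bob P y)"
    and code: "\<And>v. v \<in> insert None (Some ` set p) \<Longrightarrow> enc v < 2 ^ b \<and> dec (enc v) = v"
    and "length p \<le> r" "q \<noteq> []"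
    and "\<And>v. {last q, v} \<in> edges P (other a) (input_of (other a) x y) \<Longrightarrow> v \<in> set q"
  shows "comm_output (follow_water P b enc dec r a q) x y = odd (length (q @ p) - 1)"
  using assms
proof (induction r arbitrary: a q p)
  case (Suc r)
  let ?z = "input_of a x y"
  have un: "alice P x \<union> bob P y =
      edges P a ?z \<union> edges P (other a) (input_of (other a) x y)"
    by (cases a) auto
  have M: "matching_on W (edges P a ?z)"
    using Suc.prems(2,3) by (cases a) auto
  show ?case
  proof (cases p)
    case Nil
    \<comment> \<open>Such a vertex would extend the maximal path.\<close>
    have "\<not> (\<exists>v. v \<notin> set q \<and> {last q, v} \<in> edges P a ?z)"
      using Suc.prems(1) path_from_snoc[of "alice P x \<union> bob P y" t q] Nil
      by (auto simp: maximal_path_from_def un)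
    then have "next_pipe P a q ?z = None"
      by (simp add: next_pipe_def)
    then show ?thesis
      using Nil Suc.prems(4)[of None] by (simp add: comm_output_send_number)
  next
    case (Cons v p')
    have "path_from (alice P x \<union> bob P y) t (q @ v # p')"
      using Suc.prems(1) Cons by (simp add: maximal_path_from_def)
    from path_from_append_Cons[OF this Suc.prems(6)]
    \<comment> \<open>The other party's edges at \<open>last q\<close> lead only to visited vertices
      and \<open>v\<close> is new, so this edge belongs to \<open>a\<close>.\<close>
    have v: "v \<notin> set q" "{last q, v} \<in> edges P a ?z"
      using Suc.prems(7) un by auto
    then have "(SOME v. v \<notin> set q \<and> {last q, v} \<in> edges P a ?z) = v"
      using matching_unique[OF M] by (intro some_equality) auto
    then have nxt: "next_pipe P a q ?z = Some v"
      using v by (auto simp: next_pipe_def)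
    have other_other: "other (other a) = a"
      by (cases a) auto
    have reversed: "{v, last q} \<in> edges P a ?z"
      using v(2) by (simp add: insert_commute)
    \<comment> \<open>This is the invariant for the next round, where the roles are swapped:
      \<open>a\<close> has used up its only edge at \<open>v\<close> to arrive there from
      \<open>last q\<close>.\<close>
    have arrived: "u \<in> set (q @ [v])" if "{v, u} \<in> edges P a ?z" for u
    proof -
      have "u = last q"
        using matching_unique[OF M that reversed] .
      then show ?thesis
        using last_in_set[OF Suc.prems(6)] by simp
    qed
    have "comm_output (follow_water P b enc dec r (other a) (q @ [v])) x y =
        odd (length ((q @ [v]) @ p') - 1)"
    proof (rule Suc.IH)
      show "maximal_path_from (alice P x \<union> bob P y) t ((q @ [v]) @ p')"
        using Suc.prems(1) Cons by simp
      show "enc u < 2 ^ b \<and> dec (enc u) = u" if "u \<in> insert None (Some ` set p')" for u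
        using that Cons by (intro Suc.prems(4)) auto
      show "u \<in> set (q @ [v])"
        if "{last (q @ [v]), u} \<in> edges P (other (other a)) (input_of (other (other a)) x y)" for u
        using that by (intro arrived) (simp add: other_other)
    qed (use Suc.prems(2,3,5) Cons in auto)
    then show ?thesis
      using nxt Suc.prems(4)[of "Some v"] Cons by (simp add: comm_output_send_number)
  qed
\<comment> \<open>With no announcement left, \<open>p\<close> is empty and \<open>q\<close> is the
  whole path. The end of a path of maximal length is thus never announced, which is why
  \<open>k\<close> announcements suffice rather than \<open>k + 1\<close>.\<close>
qed simp

section \<open>Comparing the two complexities\<close>

lemma finite_cube: "finite (cube n)"
  using finite_lists_length_eq[of "UNIV :: bool set" n] by (simp add: cube_def)

text \<open>The vertices after the tap are distinct pipes, so their number, which is the number of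
  announcements to be made, equals the number of wet pipes.\<close>

lemma water_path_decomp:
  assumes P: "gh_protocol n P" and x: "x \<in> cube n" and y: "y \<in> cube n"
  obtains p where "water_path P x y = tap P # p"
    "maximal_path_from (alice P x \<union> bob P y) (tap P) (tap P # p)"
    "set p \<subseteq> pipes P" "length p \<le> gh_time n P"
proof -
  have A: "matching_on (insert (tap P) (pipes P)) (alice P x)" and B: "matching_on (pipes P) (bob P y)"
    and t: "tap P \<notin> pipes P" and V: "finite (pipes P)"
    using assms by (auto simp: gh_protocol_def)
  have max: "maximal_path_from (alice P x \<union> bob P y) (tap P) (water_path P x y)"
    unfolding water_path_def by (rule theI'[OF ex1_maximal_path_from[OF A B t V]])
  then have path: "path_from (alice P x \<union> bob P y) (tap P) (water_path P x y)"
    by (simp add: maximal_path_from_def)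
  then obtain p where p: "water_path P x y = tap P # p" "distinct (tap P # p)"
    by (cases "water_path P x y") (auto simp: path_from_def)
  have "set (tap P # p) \<subseteq> insert (tap P) (pipes P)"
    using A B by (intro path_from_subset[OF path[unfolded p(1)]]) (auto simp: matching_on_def)
  then have sub: "set p \<subseteq> pipes P"
    using p(2) by auto
  then have "wet_pipes P x y = set p"
    using p(1) t by (auto simp: wet_pipes_def)
  then have "length p = card (wet_pipes P x y)"
    using p(2) by (simp add: distinct_card)
  also have "\<dots> \<le> gh_time n P"
    unfolding gh_time_def using x y finite_cube by (intro Max_ge) auto
  finally show ?thesis
    using that p(1) max sub by simp
qed

lemma DCC_le_gh_time:
  assumes P: "gh_protocol n P" "gh_computes n P f" "gh_time n P \<le> k"
    and b: "gh_size P < 2 ^ Suc b"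
  shows "DCC n k f \<le> enat (k * Suc b)"
proof -
  have V: "finite (pipes P)"
    using P(1) by (simp add: gh_protocol_def)
  let ?S = "insert None (Some ` pipes P)"
  \<comment> \<open>The symbols, all pipes and \<open>None\<close> for the end of the path, are
    numbered from 0 without gaps, and \<open>inv_into\<close> decodes them. Strictness of
    \<open>gh_size P < 2 ^ Suc b\<close> leaves room for \<open>None\<close>.\<close>
  obtain enc N where enc: "enc ` ?S = {i::nat. i < N}" "inj_on enc ?S"
    using finite_imp_inj_to_nat_seg[of ?S] V by auto
  have "N = card ?S"
    using card_image[OF enc(2)] enc(1) by simp
  also have "\<dots> = Suc (gh_size P)"
    using V by (subst card_insert_disjoint) (auto simp: card_image gh_size_def)
  finally have "N \<le> 2 ^ Suc b"
    using b by simp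
  then have code: "enc v < 2 ^ Suc b \<and> inv_into ?S enc (enc v) = v" if "v \<in> ?S" for v
    using that enc inv_into_f_f[OF enc(2)] by (metis image_eqI mem_Collect_eq order_less_le_trans)
  define T where "T = follow_water P (Suc b) enc (inv_into ?S enc) k Alice [tap P]"
  have "comm_output T x y = f x y" if xy: "x \<in> cube n" "y \<in> cube n" for x y
  proof -
    obtain p where p: "water_path P x y = tap P # p"
      "maximal_path_from (alice P x \<union> bob P y) (tap P) (tap P # p)"
      "set p \<subseteq> pipes P" "length p \<le> gh_time n P"
      using water_path_decomp[OF P(1) xy] .
    have M: "matching_on (insert (tap P) (pipes P)) (alice P x)"
      and B: "matching_on (pipes P) (bob P y)" and "tap P \<notin> pipes P"
      using P(1) xy by (auto simp: gh_protocol_def)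
    \<comment> \<open>Bob's matching avoids the tap. This starts the invariant, as if the water had
      arrived at the tap through Bob.\<close>
    then have bob: "{tap P, v} \<notin> bob P y" for v
      unfolding matching_on_def by blast
    \<comment> \<open>The correctness lemma swaps the parties at each round, so it takes both
      matchings on one vertex set.\<close>
    have M': "matching_on (insert (tap P) (pipes P)) (bob P y)"
      using B by (rule matching_on_mono) auto
    have "comm_output T x y = odd (length ([tap P] @ p) - 1)"
      unfolding T_def
    proof (rule comm_output_follow_water[OF _ M M'])
      show "enc v < 2 ^ Suc b \<and> inv_into ?S enc (enc v) = v" if "v \<in> insert None (Some ` set p)" for v
        using that p(3) by (intro code) auto
    qed (use p P(3) bob in simp_all)
    also have "\<dots> = gh_output P x y"
      using p(1) by (simp add: gh_output_def)
    also have "\<dots> = f x y"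
      using P(2) xy by (simp add: gh_computes_def)
    finally show ?thesis .
  qed
  then have "DCC n k f \<le> enat (comm_cost T)"
    unfolding DCC_def T_def
    by (intro INF_lower) (simp add: comm_computes_def messages_follow_water alice_first_follow_water)
  also have "\<dots> \<le> enat (k * Suc b)"
    unfolding T_def by (simp only: enat_ord_simps comm_cost_follow_water)
  finally show ?thesis .
qed

lemma two_powr_div_le:
  assumes "d \<le> enat (k * b)" "1 \<le> k"
  shows "two_powr_div d k \<le> ereal (2 ^ b)"
proof -
  \<comment> \<open>The bound makes \<open>d\<close> finite, which excludes the infinite case of
    \<open>two_powr_div\<close>.\<close>
  obtain m where m: "d = enat m" "m \<le> k * b"
    using assms(1) by (cases d) auto
  then have "real m / real k \<le> real b"
    using assms(2) by (simp add: divide_le_eq mult.commute flip: of_nat_mult)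
  then have "2 powr (real m / real k) \<le> 2 powr real b"
    by simp
  then show ?thesis
    using m(1) by (simp add: two_powr_div_def powr_realpow)
qed

theorem theorem7:
  "\<exists>c::real. 0 < c \<and>
     (\<forall>(n::nat) (f :: bits \<Rightarrow> bits \<Rightarrow> bool) (k::nat). 1 \<le> k \<longrightarrow>
        ereal c * two_powr_div (DCC n k f) k \<le> ereal_of_enat (GH n k f))"
proof (intro exI[of _ "1/2"] conjI allI impI)
  fix n k :: nat and f :: "bits \<Rightarrow> bits \<Rightarrow> bool"
  assume k: "1 \<le> k"
  let ?S = "{P. gh_protocol n P \<and> gh_computes n P f \<and> gh_time n P \<le> k}"
  show "ereal (1/2) * two_powr_div (DCC n k f) k \<le> ereal_of_enat (GH n k f)"
  proof (cases "?S = {}")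
    case True
    \<comment> \<open>The infimum over the empty set is \<infinity>, so the bound is
      trivial.\<close>
    then show ?thesis
      unfolding GH_def True by (simp add: top_enat_def)
  next
    case False
    then obtain Q where "Q \<in> ?S"
      by blast
    \<comment> \<open>The order on \<open>enat\<close> is a wellorder, so the infimum is attained by
      some protocol.\<close>
    then have "GH n k f \<in> (\<lambda>P. enat (gh_size P)) ` ?S"
      unfolding GH_def by (intro wellorder_InfI[of "enat (gh_size Q)"] imageI)
    then obtain P where P: "gh_protocol n P" "gh_computes n P f" "gh_time n P \<le> k"
      and GH: "GH n k f = enat (gh_size P)"
      by blast
    have "1 \<le> gh_size P"
      using P(1) by (auto simp: gh_protocol_def gh_size_def Suc_le_eq card_gt_0_iff)
    \<comment> \<open>Having a pipe guarantees that \<open>b\<close> exists. Rounding up to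
      \<open>2 ^ (b + 1)\<close> loses at most a factor 2 against the size, hence the constant
      1/2.\<close>
    then obtain b where b: "2 ^ b \<le> gh_size P" "gh_size P < 2 ^ (b + 1)"
      using ex_power_ivl1[of 2 "gh_size P"] by (metis order_refl)
    have "two_powr_div (DCC n k f) k \<le> ereal (2 ^ Suc b)"
      using DCC_le_gh_time[OF P] b(2) k by (intro two_powr_div_le) auto
    then have "ereal (1/2) * two_powr_div (DCC n k f) k \<le> ereal (1/2) * ereal (2 ^ Suc b)"
      by (intro ereal_mult_left_mono) auto
    also have "\<dots> = ereal (real (2 ^ b))"
      by simp
    also have "\<dots> \<le> ereal (real (gh_size P))"
      using b(1) by (simp only: ereal_less_eq of_nat_le_iff)
    finally show ?thesis
      using GH by simp
  qed
qed simp

end
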